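(* In the setting described in the context (smooth and strongly convex objectives $f_1,\dots,f_m$, bounded closed convex feasible region $\mathcal{X}$, bounds on the moments of the stochastic gradients, Lipschitz continuity of the subproblem solution), let $\lambda_*\in\Delta^m$ be the limit of the sequence $\{\lambda_k\}$ and let $x_*\in\mathcal{X}$ be the corresponding Pareto minimizer, i.e. the unique minimizer of $S(\cdot,\lambda_* )$, with $\nabla_xS(x_*,\lambda_* )=0$. Assume that for every iterate $x_k$, $$\nabla_xS(x_*,\lambda_k)^\top(x_k-x_* )\;\ge\;0.$$ Let the step sizes be $\alpha_k=\frac{\gamma}{k}$, $k\ge1$, where $\gamma>\frac{1}{2c}$ is a constant. Then the sequence of iterates generated by the Stochastic Multi-Gradient algorithm with initial point $x_1$ satisfies, for every $k\ge1$, $$\mathbb{E}[\|x_k-x_*\|^2]\;\le\;\frac{\max\{2\gamma^2\bar M(2c\gamma-1)^{-1},\ \|x_1-x_*\|^2\}}{k}$$ and $$\mathbb{E}[S(x_k,\lambda_* )]-\mathbb{E}[S(x_*,\lambda_* )]\;\le\;\frac{(L/2)\max\{2\gamma^2\bar M(2c\gamma-1)^{-1},\ \|x_1-x_*\|^2\}}{k},$$ where $\bar M=L_g^2+2\Theta(L_{\nabla S}+\beta L_{\nabla S}M_S)$.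
   Context: **Problem.** Let $m\ge 2$, let $\mathcal{X}\subset\mathbb{R}^n$ be nonempty, closed and convex, let $w$ be a random variable whose distribution does not depend on $x$, and let $f_i:\mathbb{R}^n\to\mathbb{R}$, $f_i(x)=\mathbb{E}[f_i(x,w)]$, $i=1,\dots,m$. The stochastic multi-objective problem is to minimize $F(x)=(f_1(x),\dots,f_m(x))^\top$ over $x\in\mathcal{X}$. Norms are Euclidean. Let $\Delta^m=\{\lambda\in\mathbb{R}^m:\sum_{i=1}^m\lambda_i=1,\ \lambda_i\ge 0\ \forall i\}$ and $S(x,\lambda)=\sum_{i=1}^m\lambda_i f_i(x)$, so $\nabla_xS(x,\lambda)=\sum_{i=1}^m\lambda_i\nabla f_i(x)$. **Algorithm (Stochastic Multi-Gradient, SMG).** Let $\{w_k\}$ be independent copies of $w$ and $\{\alpha_k\}$ positive step sizes. Start from a (deterministic) point $x_1\in\mathcal{X}$. For $k=1,2,\dots$: compute stochastic gradients $g_i(x_k,w_k)\in\mathbb{R}^n$, $i=1,\dots,m$; compute $\lambda^g_k\in\operatorname{argmin}_{\lambda\in\Delta^m}\|\sum_{i=1}^m\lambda_i g_i(x_k,w_k)\|^2$; set $g(x_k,w_k)=\sum_{i=1}^m(\lambda^g_k)_i\,g_i(x_k,w_k)$; set $x_{k+1}=P_{\mathcal{X}}(x_k-\alpha_k g(x_k,w_k))$, where $P_{\mathcal{X}}$ is the orthogonal projection onto $\mathcal{X}$. In addition, $\lambda_k$ denotes the solution in the corresponding subproblem with true gradients: $\lambda_k\in\operatorname{argmin}_{\lambda\in\Delta^m}\|\sum_{i=1}^m\lambda_i\nabla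 f_i(x_k)\|^2$. It is assumed that the whole sequence $\{\lambda_k\}$ converges (almost surely) to a deterministic $\lambda_*\in\Delta^m$. $\mathbb{E}_{w_k}[\cdot]$ is the expectation with respect to $w_k$ ($x_k$ does not depend on $w_k$ and is held fixed), $\mathbb{V}_{w_k}[Y]=\mathbb{E}_{w_k}[\|Y\|^2]-\|\mathbb{E}_{w_k}[Y]\|^2$, and $\mathbb{E}[\cdot]$ is the expectation with respect to the joint distribution of $\{w_k\}$. **Assumptions.** 1. (Lipschitz gradients) Each $f_i$ is continuously differentiable and $\|\nabla f_i(x)-\nabla f_i(\bar x)\|\le L_i\|x-\bar x\|$ for all $x,\bar x\in\mathbb{R}^n$, with $L_i>0$. Put $L=\max_iL_i$. 2. (Stochastic gradients) For all $i$ and all iterates $k$: (a) $\mathbb{E}_{w_k}[g_i(x_k,w_k)]=\nabla f_i(x_k)$; (b) there are constants $C_i,\hat C_i>0$ (independent of $k$) with $\mathbb{E}_{w_k}[\|g_i(x_k,w_k)-\nabla f_i(x_k)\|]\le\alpha_k(C_i+\hat C_i\|\nabla f_i(x_k)\|)$; (c) there are constants $G_i,\hat G_i>0$ (independent of $k$) with $\mathbb{V}_{w_k}[g_i(x_k,w_k)]\le G_i^2+\hat G_i^2\|\nabla f_i(x_k)\|^2$. 3. (Bounded feasible region) $\mathcal{X}$ is bounded; $\Theta>0$ is a finite constant with $\max_{x,y\in\mathcal{X}}\|x-y\|\le\Theta$. 4. (Subproblem Lipschitz continuity) The optimal solution of $\min_{\lambda\in\Delta^m}\|\sum_i\lambda_iv_i\|^2$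 is a Lipschitz function $\lambda(v_1,\dots,v_m)$ of the parameters, on the set of parameter tuples that arise (the tuples $(\nabla f_1(x),\dots,\nabla f_m(x))$, $x\in\mathcal{X}$, and the tuples of stochastic gradients $(g_1(x_k,w_k),\dots,g_m(x_k,w_k))$): there is $\beta>0$ with $\|\lambda(v_1,\dots,v_m)-\lambda(v_1',\dots,v_m')\|\le\beta\,\|[(v_1-v_1')^\top,\dots,(v_m-v_m')^\top]\|$ for all such tuples. Here $\lambda_k=\lambda(\nabla f_1(x_k),\dots,\nabla f_m(x_k))$ and $\lambda_k^g=\lambda(g_1(x_k,w_k),\dots,g_m(x_k,w_k))$. 5. (Strong convexity) For each $i$ there is $c_i>0$ with $f_i(\bar x)\ge f_i(x)+\nabla f_i(x)^\top(\bar x-x)+\frac{c_i}{2}\|\bar x-x\|^2$ for all $x,\bar x\in\mathbb{R}^n$. Put $c=\min_ic_i$. **Constants.** $M_\nabla$ is the largest of the norms $\|\nabla f_i\|$, $i=1,\dots,m$, at an arbitrary fixed point of $\mathcal{X}$; $M_1=\sum_{i=1}^mC_i$; $M_F=\max_i\hat C_i$; $G^2=m\sum_{i=1}^mG_i^2$; $G_V^2=m\max_i(\hat G_i^2+1)$; $L_{\nabla S}=M_1+mM_F(M_\nabla+L\Theta)$; $L_g^2=G^2+mG_V^2(M_\nabla+L\Theta)^2$; $M_S=\sqrt{mn}\,(M_\nabla+L\Theta)$. *)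

theory Defs
  imports "HOL-Probability.Probability"
begin

(* Meaningful only at points where f is differentiable. *)
definition gradient :: "('a::real_inner \<Rightarrow> real) \<Rightarrow> 'a \<Rightarrow> 'a" where
  "gradient f x = (THE D. GDERIV f x :> D)"

definition simplex_weights :: "(real ^ 'm) set" where
  "simplex_weights = {l. (\<Sum>i\<in>UNIV. l $ i) = 1 \<and> (\<forall>i. 0 \<le> l $ i)}"

definition weighted_sum :: "('m::finite \<Rightarrow> real ^ 'n \<Rightarrow> real) \<Rightarrow> real ^ 'n \<Rightarrow> real ^ 'm \<Rightarrow> real" where
  "weighted_sum f x l = (\<Sum>i\<in>UNIV. l $ i * f i x)"

definition combination :: "real ^ 'm \<Rightarrow> real ^ 'n ^ 'm \<Rightarrow> real ^ 'n" where
  "combination l v = (\<Sum>i\<in>UNIV. l $ i *\<^sub>R v $ i)"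

definition subproblem_solutions :: "real ^ 'n ^ 'm \<Rightarrow> (real ^ 'm) set" where
  "subproblem_solutions v =
     {l. is_arg_min (\<lambda>l. (norm (combination l v))\<^sup>2) (\<lambda>l. l \<in> simplex_weights) l}"

definition grad_tuple :: "('m::finite \<Rightarrow> real ^ 'n \<Rightarrow> real) \<Rightarrow> real ^ 'n \<Rightarrow> real ^ 'n ^ 'm" where
  "grad_tuple f x = (\<chi> i. gradient (f i) x)"

definition stoch_tuple ::
    "('m::finite \<Rightarrow> real ^ 'n \<Rightarrow> 'w \<Rightarrow> real ^ 'n) \<Rightarrow> real ^ 'n \<Rightarrow> 'w \<Rightarrow> real ^ 'n ^ 'm" where
  "stoch_tuple g x v = (\<chi> i. g i x v)"

(* One sample path: v is the realized noise sequence, lg the weights solving the stochastic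
   subproblems and x the iterates. Indices start at 1; values at index 0 are irrelevant. *)
definition SMG_path ::
    "(real ^ 'n) set \<Rightarrow> ('m::finite \<Rightarrow> real ^ 'n \<Rightarrow> 'w \<Rightarrow> real ^ 'n) \<Rightarrow> (nat \<Rightarrow> real) \<Rightarrow> real ^ 'n
     \<Rightarrow> (nat \<Rightarrow> 'w) \<Rightarrow> (nat \<Rightarrow> real ^ 'm) \<Rightarrow> (nat \<Rightarrow> real ^ 'n) \<Rightarrow> bool" where
  "SMG_path X g \<alpha> x1 v lg x \<longleftrightarrow>
     x 1 = x1 \<and>
     (\<forall>k\<ge>1. lg k \<in> subproblem_solutions (stoch_tuple g (x k) (v k)) \<and>
            x (Suc k) = closest_point X (x k - \<alpha> k *\<^sub>R combination (lg k) (stoch_tuple g (x k) (v k))))"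

definition vec_variance :: "'a measure \<Rightarrow> ('a \<Rightarrow> real ^ 'n) \<Rightarrow> real" where
  "vec_variance M Y = (\<integral>\<omega>. (norm (Y \<omega>))\<^sup>2 \<partial>M) - (norm (\<integral>\<omega>. Y \<omega> \<partial>M))\<^sup>2"

(* The norm on real ^ 'n ^ 'm is the Euclidean norm of the concatenated vectors. *)
definition arising_tuples ::
    "'a measure \<Rightarrow> (real ^ 'n) set \<Rightarrow> ('m::finite \<Rightarrow> real ^ 'n \<Rightarrow> real)
     \<Rightarrow> ('m \<Rightarrow> real ^ 'n \<Rightarrow> 'w \<Rightarrow> real ^ 'n) \<Rightarrow> (nat \<Rightarrow> 'a \<Rightarrow> 'w) \<Rightarrow> (nat \<Rightarrow> 'a \<Rightarrow> real ^ 'n)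
     \<Rightarrow> (real ^ 'n ^ 'm) set" where
  "arising_tuples M X f g W x =
     grad_tuple f ` X \<union> {stoch_tuple g (x k \<omega>) (W k \<omega>) | k \<omega>. k \<ge> 1 \<and> \<omega> \<in> space M}"

end

theory Submission
  imports Defs
begin

text \<open>
  Write \<open>v\<close>, \<open>v'\<close> for the tuples of stochastic and true gradients at \<open>x\<^sub>k\<close> and \<open>l\<close>, \<open>l'\<close> for the
  associated weights. Nonexpansiveness of the projection and strong convexity give, along every path,
  a contraction by \<open>1 - 2 \<alpha>\<^sub>k c\<close> up to the bias \<open>\<parallel>\<Sum> l v - \<Sum> l' v'\<parallel>\<close> and the second moment
  \<open>\<parallel>v\<parallel>\<^sup>2\<close>. The weights are Lipschitz, so the bias is at most \<open>(1 + \<beta> M\<^sub>S) \<parallel>v - v'\<parallel>\<close>. Since \<open>x\<^sub>k\<close> is a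
  function of \<open>w\<^sub>1, \<dots>, w\<^sub>k\<^sub>-\<^sub>1\<close>, it is independent of \<open>w\<^sub>k\<close>, and the moment assumptions bound the
  expectations of \<open>\<parallel>v - v'\<parallel>\<close> and \<open>\<parallel>v\<parallel>\<^sup>2\<close>.
  The resulting recursion is solved by induction as usual once \<open>k \<ge> 2 c \<gamma>\<close>. For smaller \<open>k\<close> the
  contraction factor may be negative; there the claim holds because the left-hand side is at most
  \<open>\<Theta>\<^sup>2\<close>, while \<open>m \<ge> 2\<close> and \<open>c \<le> L\<close> force \<open>4 c\<^sup>2 \<Theta>\<^sup>2\<close> to be a lower bound of the constant \<open>Mbar\<close>.
\<close>

section \<open>Gradients\<close>

text \<open>Makes the definite description in \<open>gradient\<close> usable: two representing
  vectors induce the same derivative, hence have the same inner product with every vector.\<close>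

lemma GDERIV_gradient_eq:
  assumes "GDERIV f y :> D"
  shows "gradient f y = D"
  unfolding gradient_def
proof (rule the_equality)
  show "GDERIV f y :> D" by (rule assms)
next
  fix D' assume "GDERIV f y :> D'"
  then have "(\<lambda>h. h \<bullet> D') = (\<lambda>h. h \<bullet> D)"
    using assms has_derivative_unique unfolding gderiv_def by blast
  then show "D' = D"
    by (metis inner_commute vector_eq_ldot)
qed

lemma GDERIV_gradient:
  fixes f :: "'a::euclidean_space \<Rightarrow> real"
  assumes "f differentiable (at y)"
  shows "GDERIV f y :> gradient f y"
proof -
  obtain f' where f': "(f has_derivative f') (at y)"
    using assms unfolding differentiable_def by blast
  interpret linear f' using f' by (rule has_derivative_linear)
  \<comment> \<open>Riesz representation in coordinates: expand \<open>h\<close> in the orthonormal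
    basis and use linearity of \<open>f'\<close>.\<close>
  have "f' = (\<lambda>h. h \<bullet> (\<Sum>b\<in>Basis. f' b *\<^sub>R b))"
  proof
    fix h :: 'a
    have "f' h = f' (\<Sum>b\<in>Basis. (h \<bullet> b) *\<^sub>R b)" by (simp add: euclidean_representation)
    also have "\<dots> = h \<bullet> (\<Sum>b\<in>Basis. f' b *\<^sub>R b)"
      by (simp add: sum scaleR inner_sum_right mult.commute)
    finally show "f' h = h \<bullet> (\<Sum>b\<in>Basis. f' b *\<^sub>R b)" .
  qed
  then have "GDERIV f y :> (\<Sum>b\<in>Basis. f' b *\<^sub>R b)"
    unfolding gderiv_def using f' by simp
  then show ?thesis using GDERIV_gradient_eq by metis
qed

lemma GDERIV_sum:
  assumes "\<And>i. i \<in> I \<Longrightarrow> GDERIV (f i) y :> D i"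
  shows "GDERIV (\<lambda>y. \<Sum>i\<in>I. f i y) y :> (\<Sum>i\<in>I. D i)"
  using assms unfolding gderiv_def inner_sum_right by (rule has_derivative_sum)

lemma gradient_weighted_sum:
  assumes "\<And>i. f i differentiable (at y)"
  shows "gradient (\<lambda>y. weighted_sum f y l) y = combination l (grad_tuple f y)"
  unfolding weighted_sum_def combination_def grad_tuple_def vec_lambda_beta
proof (intro GDERIV_gradient_eq GDERIV_sum)
  fix i
  have "GDERIV (f i) y :> gradient (f i) y" using assms by (rule GDERIV_gradient)
  then show "GDERIV (\<lambda>y. l $ i * f i y) y :> l $ i *\<^sub>R gradient (f i) y"
    unfolding gderiv_def inner_scaleR_right by (rule has_derivative_mult_right)
qed

text \<open>The descent lemma. On the segment from \<open>y\<close> to \<open>z\<close>,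
  \<open>p\<close> is \<open>f\<close> minus its linear part and the quadratic correction;
  Cauchy-Schwarz and the Lipschitz bound make its derivative nonpositive, so
  \<open>p 1 \<le> p 0\<close>.\<close>

lemma lipschitz_gradient_upper_bound:
  fixes f :: "'a::euclidean_space \<Rightarrow> real"
  assumes diff: "\<And>y. f differentiable (at y)"
    and lip: "\<And>y z. norm (gradient f y - gradient f z) \<le> K * norm (y - z)"
  shows "f z \<le> f y + gradient f y \<bullet> (z - y) + K / 2 * (norm (z - y))\<^sup>2"
proof -
  define d where "d = z - y"
  define p where "p t = f (y + t *\<^sub>R d) - t * (gradient f y \<bullet> d) - K / 2 * t\<^sup>2 * (norm d)\<^sup>2" for t
  have deriv: "(p has_real_derivative
      gradient f (y + t *\<^sub>R d) \<bullet> d - gradient f y \<bullet> d - K * t * (norm d)\<^sup>2) (at t)" for t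
  proof -
    have 1: "((\<lambda>t. y + t *\<^sub>R d) has_derivative (\<lambda>h. h *\<^sub>R d)) (at t)"
      by (auto intro!: derivative_eq_intros)
    have 2: "(f has_derivative (\<lambda>h. h \<bullet> gradient f (y + t *\<^sub>R d))) (at (y + t *\<^sub>R d))"
      using GDERIV_gradient[OF diff] unfolding gderiv_def .
    have "((\<lambda>t. f (y + t *\<^sub>R d)) has_real_derivative gradient f (y + t *\<^sub>R d) \<bullet> d) (at t)"
      unfolding has_field_derivative_def
      using has_derivative_compose[OF 1 2] by (simp add: inner_commute mult_commute_abs)
    then show ?thesis unfolding p_def
      by (auto intro!: derivative_eq_intros)
  qed
  have "p 1 \<le> p 0"
  proof (rule DERIV_nonpos_imp_nonincreasing[of 0 1])
    fix t :: real assume t: "0 \<le> t" "t \<le> 1"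
    have "(gradient f (y + t *\<^sub>R d) - gradient f y) \<bullet> d
        \<le> norm (gradient f (y + t *\<^sub>R d) - gradient f y) * norm d"
      by (rule norm_cauchy_schwarz)
    also have "\<dots> \<le> (K * norm (t *\<^sub>R d)) * norm d"
      using lip[of "y + t *\<^sub>R d" y] by (intro mult_right_mono) auto
    also have "\<dots> = K * t * (norm d)\<^sup>2"
      using t by (simp add: power2_eq_square)
    finally have "gradient f (y + t *\<^sub>R d) \<bullet> d - gradient f y \<bullet> d - K * t * (norm d)\<^sup>2 \<le> 0"
      by (simp add: inner_diff_left)
    with deriv show "\<exists>D. DERIV p t :> D \<and> D \<le> 0" by blast
  qed simp
  then show ?thesis by (simp add: p_def d_def)
qed

text \<open>Add the two instances with \<open>y\<close> and \<open>z\<close> exchanged: the function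
  values cancel and the quadratic terms add up.\<close>

lemma strongly_convex_monotone_gradient:
  fixes f :: "'a::euclidean_space \<Rightarrow> real"
  assumes "\<And>y z. f z \<ge> f y + gradient f y \<bullet> (z - y) + c / 2 * (norm (z - y))\<^sup>2"
  shows "c * (norm (z - y))\<^sup>2 \<le> (gradient f z - gradient f y) \<bullet> (z - y)"
  using assms[of z y] assms[of y z]
  by (simp add: algebra_simps inner_diff_right inner_diff_left norm_minus_commute)

section \<open>Combinations of gradient tuples\<close>

text \<open>Triangle inequality, then Cauchy-Schwarz over the index; the norm of a tuple is the
  Euclidean norm of the norms of its entries.\<close>

lemma norm_combination_le: "norm (combination l v) \<le> norm l * norm v"
proof -
  have "norm (combination l v) \<le> (\<Sum>i\<in>UNIV. \<bar>l $ i\<bar> * \<bar>norm (v $ i)\<bar>)"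
    unfolding combination_def by (rule order_trans[OF norm_sum]) simp
  also have "\<dots> \<le> L2_set (\<lambda>i. l $ i) UNIV * L2_set (\<lambda>i. norm (v $ i)) UNIV"
    by (rule L2_set_mult_ineq)
  finally show ?thesis by (simp add: norm_vec_def L2_set_def)
qed

lemma combination_diff_left: "combination (l - l') v = combination l v - combination l' v"
  by (simp add: combination_def scaleR_diff_left sum_subtractf)

lemma combination_diff_right: "combination l (v - v') = combination l v - combination l v'"
  by (simp add: combination_def scaleR_diff_right sum_subtractf)

lemma norm_simplex_weights_le_1:
  assumes "l \<in> simplex_weights"
  shows "norm l \<le> 1"
  using norm_le_l1_cart[of l] assms by (simp add: simplex_weights_def)

lemma subproblem_solutions_simplex: "subproblem_solutions v \<subseteq> simplex_weights"
  by (auto simp: subproblem_solutions_def is_arg_min_def)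

lemma norm_vec_le_sum: "norm (v :: 'b::real_normed_vector ^ 'm) \<le> (\<Sum>i\<in>UNIV. norm (v $ i))"
  unfolding norm_vec_def by (rule L2_set_le_sum) simp

lemma norm_vec_power2: "(norm (v :: 'b::real_normed_vector ^ 'm))\<^sup>2 = (\<Sum>i\<in>UNIV. (norm (v $ i))\<^sup>2)"
  by (simp add: norm_vec_def L2_set_def sum_nonneg)

lemma norm_vec_le_sqrt_card:
  fixes v :: "'b::real_normed_vector ^ 'm"
  assumes "\<And>i. norm (v $ i) \<le> B"
  shows "norm v \<le> sqrt (real CARD('m)) * B"
proof -
  have B: "0 \<le> B" using assms[of undefined] norm_ge_zero order_trans by blast
  have "(norm v)\<^sup>2 \<le> (\<Sum>i\<in>(UNIV::'m set). B\<^sup>2)"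
    unfolding norm_vec_power2 by (rule sum_mono) (simp add: assms power_mono)
  then have "(norm v)\<^sup>2 \<le> (sqrt (real CARD('m)) * B)\<^sup>2"
    by (simp add: power_mult_distrib)
  then show ?thesis by (rule power2_le_imp_le) (simp add: B)
qed

text \<open>A point \<open>z\<close> of \<open>X\<close> is its own projection, so nonexpansiveness
  reduces the claim to the unprojected step, whose square is expanded.\<close>

lemma projected_step_dist:
  fixes X :: "'a::euclidean_space set"
  assumes "convex X" "closed X" "z \<in> X"
  shows "(norm (closest_point X (y - a *\<^sub>R v) - z))\<^sup>2
    \<le> (norm (y - z))\<^sup>2 - 2 * a * (v \<bullet> (y - z)) + a\<^sup>2 * (norm v)\<^sup>2"
proof -
  have "norm (closest_point X (y - a *\<^sub>R v) - z) \<le> norm (y - a *\<^sub>R v - z)"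
    using closest_point_lipschitz[of X "y - a *\<^sub>R v" z] assms
    by (auto simp: dist_norm closest_point_self)
  then have "(norm (closest_point X (y - a *\<^sub>R v) - z))\<^sup>2 \<le> (norm (y - z - a *\<^sub>R v))\<^sup>2"
    by (simp add: power_mono algebra_simps)
  also have "\<dots> = (norm (y - z))\<^sup>2 - 2 * a * (v \<bullet> (y - z)) + a\<^sup>2 * (norm v)\<^sup>2"
    by (simp only: power2_norm_eq_inner)
      (simp add: inner_diff inner_commute algebra_simps power2_eq_square)
  finally show ?thesis .
qed

lemma combination_gradient_strongly_monotone:
  assumes "l \<in> simplex_weights" and "\<And>i. c \<le> ci i"
    and "\<And>i y z. f i z \<ge> f i y + gradient (f i) y \<bullet> (z - y) + ci i / 2 * (norm (z - y))\<^sup>2"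
  shows "c * (norm (y - z))\<^sup>2
    \<le> (combination l (grad_tuple f y) - combination l (grad_tuple f z)) \<bullet> (y - z)"
proof -
  have "c * (norm (y - z))\<^sup>2 = (\<Sum>i\<in>UNIV. l $ i * (c * (norm (y - z))\<^sup>2))"
    using assms(1) by (simp add: simplex_weights_def flip: sum_distrib_right)
  also have "\<dots> \<le> (\<Sum>i\<in>UNIV. l $ i * ((gradient (f i) y - gradient (f i) z) \<bullet> (y - z)))"
  proof (intro sum_mono mult_left_mono)
    fix i
    have "c * (norm (y - z))\<^sup>2 \<le> ci i * (norm (y - z))\<^sup>2"
      using assms(2) by (intro mult_right_mono) auto
    also have "\<dots> \<le> (gradient (f i) y - gradient (f i) z) \<bullet> (y - z)"
      using assms(3) by (rule strongly_convex_monotone_gradient)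
    finally show "c * (norm (y - z))\<^sup>2 \<le> (gradient (f i) y - gradient (f i) z) \<bullet> (y - z)" .
  qed (use assms(1) in \<open>simp add: simplex_weights_def\<close>)
  also have "\<dots> = (combination l (grad_tuple f y) - combination l (grad_tuple f z)) \<bullet> (y - z)"
    by (simp add: combination_def grad_tuple_def inner_sum_left flip: sum_subtractf scaleR_diff_right)
  finally show ?thesis .
qed

lemma weighted_sum_upper_bound:
  assumes "l \<in> simplex_weights"
    and "\<And>i y. f i differentiable (at y)"
    and "\<And>i y z. norm (gradient (f i) y - gradient (f i) z) \<le> K * norm (y - z)"
  shows "weighted_sum f z l
    \<le> weighted_sum f y l + combination l (grad_tuple f y) \<bullet> (z - y) + K / 2 * (norm (z - y))\<^sup>2"
proof -
  have "weighted_sum f z l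
      \<le> (\<Sum>i\<in>UNIV. l $ i * (f i y + gradient (f i) y \<bullet> (z - y) + K / 2 * (norm (z - y))\<^sup>2))"
    unfolding weighted_sum_def using assms(1)
    by (intro sum_mono mult_left_mono lipschitz_gradient_upper_bound assms(2,3))
      (simp add: simplex_weights_def)
  also have "\<dots> = weighted_sum f y l + combination l (grad_tuple f y) \<bullet> (z - y)
      + (\<Sum>i\<in>UNIV. l $ i) * (K / 2 * (norm (z - y))\<^sup>2)"
    by (simp only: weighted_sum_def combination_def grad_tuple_def inner_sum_left sum_distrib_right
        flip: sum.distrib) (simp add: algebra_simps)
  finally show ?thesis using assms(1) by (simp add: simplex_weights_def)
qed

text \<open>One iteration on one sample path: \<open>z\<close> stands for the minimizer, primed data
  for the true gradients. The contraction comes from \<open>mono\<close>, and using the stochastic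
  direction instead of the true one costs the middle term.\<close>

lemma multi_gradient_step_bound:
  assumes X: "convex X" "closed X" "z \<in> X" and "0 \<le> a" "0 \<le> \<beta>"
    and l: "norm l \<le> 1" "norm (l - l') \<le> \<beta> * norm (v - v')"
    and S: "norm v' \<le> S" and \<Theta>: "norm (y - z) \<le> \<Theta>"
    and mono: "c * (norm (y - z))\<^sup>2 \<le> combination l' v' \<bullet> (y - z)"
  shows "(norm (closest_point X (y - a *\<^sub>R combination l v) - z))\<^sup>2
    \<le> (1 - 2 * a * c) * (norm (y - z))\<^sup>2 + 2 * a * \<Theta> * (1 + \<beta> * S) * norm (v - v') + a\<^sup>2 * (norm v)\<^sup>2"
proof -
  \<comment> \<open>Splitting through \<open>combination l v'\<close> pairs each difference with a
    bounded factor, \<open>norm l \<le> 1\<close> or \<open>norm v' \<le> S\<close>;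
    \<open>v\<close> itself has no pathwise bound.\<close>
  have "combination l' v' - combination l v = - (combination l (v - v') + combination (l - l') v')"
    by (simp add: combination_diff_left combination_diff_right)
  then have "norm (combination l' v' - combination l v)
      \<le> norm (combination l (v - v')) + norm (combination (l - l') v')"
    by (metis norm_minus_cancel norm_triangle_ineq)
  also have "\<dots> \<le> norm l * norm (v - v') + norm (l - l') * norm v'"
    by (intro add_mono norm_combination_le)
  also have "\<dots> \<le> 1 * norm (v - v') + (\<beta> * norm (v - v')) * S"
    using l S \<open>0 \<le> \<beta>\<close> by (intro add_mono mult_mono) auto
  finally have err: "norm (combination l' v' - combination l v) \<le> (1 + \<beta> * S) * norm (v - v')"
    by (simp add: algebra_simps)
  have "(combination l' v' - combination l v) \<bullet> (y - z)
      \<le> norm (combination l' v' - combination l v) * norm (y - z)"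
    by (rule norm_cauchy_schwarz)
  also have "\<dots> \<le> ((1 + \<beta> * S) * norm (v - v')) * \<Theta>"
    using err \<Theta> order_trans[OF norm_ge_zero err] by (intro mult_mono) auto
  finally have "c * (norm (y - z))\<^sup>2 - \<Theta> * (1 + \<beta> * S) * norm (v - v') \<le> combination l v \<bullet> (y - z)"
    using mono by (simp add: inner_diff_left algebra_simps)
  then have "2 * a * (c * (norm (y - z))\<^sup>2 - \<Theta> * (1 + \<beta> * S) * norm (v - v'))
      \<le> 2 * a * (combination l v \<bullet> (y - z))"
    using \<open>0 \<le> a\<close> by (intro mult_left_mono) auto
  moreover have "(norm (combination l v))\<^sup>2 \<le> (norm v)\<^sup>2"
    using norm_combination_le[of l v] mult_right_mono[OF l(1), of "norm v"]
    by (intro power_mono) auto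
  then have "a\<^sup>2 * (norm (combination l v))\<^sup>2 \<le> a\<^sup>2 * (norm v)\<^sup>2"
    by (intro mult_left_mono) auto
  ultimately show ?thesis
    using projected_step_dist[OF X, of y a "combination l v"] by (simp add: algebra_simps)
qed

section \<open>Measurability and independence\<close>

text \<open>The set \<open>U\<close> need not be Borel, so \<open>f\<close> is first extended to the
  closure, which is closed and hence Borel; the value 0 outside keeps measurability.\<close>

lemma lipschitz_on_borel_extension:
  fixes f :: "'a::metric_space \<Rightarrow> 'b::euclidean_space"
  assumes "K-lipschitz_on U f"
  obtains h where "h \<in> borel_measurable borel" "\<And>u. u \<in> U \<Longrightarrow> h u = f u"
proof -
  obtain h where h: "K-lipschitz_on (closure U) h" "\<And>u. u \<in> U \<Longrightarrow> h u = f u"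
    using lipschitz_extend_closure[OF assms] by blast
  have "(\<lambda>u. indicator (closure U) u *\<^sub>R h u) \<in> borel_measurable borel"
    using h(1) lipschitz_on_continuous_on
    by (intro borel_measurable_continuous_on_indicator) auto
  then show ?thesis
    using h(2) closure_subset[of U] by (intro that[of "\<lambda>u. indicator (closure U) u *\<^sub>R h u"]) (auto simp: indicator_def)
qed

lemma measurable_stoch_tuple:
  fixes g :: "'a::finite \<Rightarrow> real ^ 'b \<Rightarrow> 'w \<Rightarrow> real ^ 'b"
  assumes "\<And>i. (\<lambda>(y, v). g i y v) \<in> borel_measurable (borel \<Otimes>\<^sub>M N)"
  shows "(\<lambda>(y, v). stoch_tuple g y v) \<in> borel_measurable (borel \<Otimes>\<^sub>M N)"
proof (subst borel_measurable_euclidean_space, intro ballI)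
  fix b :: "real ^ 'b ^ 'a" assume "b \<in> Basis"
  then obtain i u where b: "b = axis i u" by (auto simp: Basis_vec_def)
  show "(\<lambda>p. (case p of (y, v) \<Rightarrow> stoch_tuple g y v) \<bullet> b) \<in> borel_measurable (borel \<Otimes>\<^sub>M N)"
    using assms[of i] by (simp add: b inner_axis stoch_tuple_def case_prod_beta borel_measurable_inner)
qed

lemma measurable_multi_gradient_step:
  assumes "\<And>i. (\<lambda>(y, v). g i y v) \<in> borel_measurable (borel \<Otimes>\<^sub>M N)"
    and X: "convex X" "closed X" "X \<noteq> {}"
    and h: "h \<in> borel_measurable borel"
  shows "(\<lambda>(y, v). closest_point X (y - a *\<^sub>R combination (h (stoch_tuple g y v)) (stoch_tuple g y v)))
    \<in> (borel \<Otimes>\<^sub>M N) \<rightarrow>\<^sub>M borel"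
proof -
  have t: "(\<lambda>p. stoch_tuple g (fst p) (snd p)) \<in> borel_measurable (borel \<Otimes>\<^sub>M N)"
    using measurable_stoch_tuple[of g N] assms(1) by (simp add: case_prod_beta)
  have "(\<lambda>p. combination (h (stoch_tuple g (fst p) (snd p))) (stoch_tuple g (fst p) (snd p)))
      \<in> borel_measurable (borel \<Otimes>\<^sub>M N)"
    by (intro borel_measurable_continuous_Pair[OF measurable_compose[OF t h] t])
      (auto simp: combination_def intro!: continuous_intros)
  then have "(\<lambda>p. fst p - a *\<^sub>R combination (h (stoch_tuple g (fst p) (snd p))) (stoch_tuple g (fst p) (snd p)))
      \<in> borel_measurable (borel \<Otimes>\<^sub>M N)"
    by (intro borel_measurable_diff borel_measurable_scaleR measurable_fst measurable_const) auto
  moreover have "closest_point X \<in> borel_measurable borel"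
    using X by (intro borel_measurable_continuous_onI continuous_on_closest_point)
  ultimately show ?thesis
    unfolding case_prod_beta by (rule measurable_compose)
qed

text \<open>
  Independence is expressed by the product form of the joint law because \<^const>\<open>prob_space.indep_var\<close>
  forces both variables to have the same type.
\<close>

lemma (in prob_space) joint_distr_expectation_bound:
  fixes S :: "'b measure" and T :: "'c measure" and h :: "'b \<Rightarrow> 'c \<Rightarrow> real"
  assumes Y: "random_variable S Y" and V: "random_variable T V"
    and joint: "distr M (S \<Otimes>\<^sub>M T) (\<lambda>\<omega>. (Y \<omega>, V \<omega>)) = distr M S Y \<Otimes>\<^sub>M distr M T V"
    and h: "(\<lambda>(y, v). h y v) \<in> borel_measurable (S \<Otimes>\<^sub>M T)"
    and nonneg: "\<And>y v. 0 \<le> h y v" and "0 \<le> B"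
    and inner: "AE \<omega> in M. integrable M (\<lambda>\<omega>'. h (Y \<omega>) (V \<omega>')) \<and> (\<integral>\<omega>'. h (Y \<omega>) (V \<omega>') \<partial>M) \<le> B"
  shows "integrable M (\<lambda>\<omega>. h (Y \<omega>) (V \<omega>))" and "(\<integral>\<omega>. h (Y \<omega>) (V \<omega>) \<partial>M) \<le> B"
proof -
  note Y[measurable] V[measurable]
  interpret DV: prob_space "distr M T V" by (rule prob_space_distr) fact
  note h[measurable]
  have hd: "(\<lambda>(y, v). ennreal (h y v)) \<in> borel_measurable (distr M S Y \<Otimes>\<^sub>M distr M T V)"
    by measurable
  \<comment> \<open>Tonelli for nonnegative integrals requires no joint integrability of
    \<open>h\<close> in advance; the finite bound yields it afterwards.\<close>
  have "(\<integral>\<^sup>+\<omega>. ennreal (h (Y \<omega>) (V \<omega>)) \<partial>M)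
      = (\<integral>\<^sup>+p. (\<lambda>(y, v). ennreal (h y v)) p \<partial>distr M (S \<Otimes>\<^sub>M T) (\<lambda>\<omega>. (Y \<omega>, V \<omega>)))"
    by (subst nn_integral_distr) auto
  also have "\<dots> = (\<integral>\<^sup>+y. \<integral>\<^sup>+v. ennreal (h y v) \<partial>distr M T V \<partial>distr M S Y)"
    unfolding joint by (subst DV.nn_integral_fst[symmetric, OF hd]) simp
  also have "\<dots> = (\<integral>\<^sup>+\<omega>. \<integral>\<^sup>+v. ennreal (h (Y \<omega>) v) \<partial>distr M T V \<partial>M)"
    by (subst nn_integral_distr) auto
  \<comment> \<open>The law of \<open>V\<close> is pulled back to a second sample point
    \<open>\<omega>'\<close>, which expresses the expectation over \<open>V\<close> with
    \<open>Y \<omega>\<close> held fixed.\<close>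
  also have "\<dots> = (\<integral>\<^sup>+\<omega>. \<integral>\<^sup>+\<omega>'. ennreal (h (Y \<omega>) (V \<omega>')) \<partial>M \<partial>M)"
    by (intro nn_integral_cong nn_integral_distr) auto
  also have "\<dots> \<le> (\<integral>\<^sup>+\<omega>. ennreal B \<partial>M)"
    using inner by (intro nn_integral_mono_AE, elim AE_mp)
      (auto simp: nn_integral_eq_integral nonneg intro!: AE_I2 ennreal_leI)
  also have "\<dots> = ennreal B" by (simp add: emeasure_space_1)
  finally have le: "(\<integral>\<^sup>+\<omega>. ennreal (h (Y \<omega>) (V \<omega>)) \<partial>M) \<le> ennreal B" .
  show int: "integrable M (\<lambda>\<omega>. h (Y \<omega>) (V \<omega>))"
    using le_less_trans[OF le] by (intro integrableI_nonneg) (auto simp: nonneg)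
  show "(\<integral>\<omega>. h (Y \<omega>) (V \<omega>) \<partial>M) \<le> B"
    using le \<open>0 \<le> B\<close> by (simp add: nn_integral_eq_integral[OF int] nonneg)
qed

text \<open>By induction \<open>x k\<close> is a measurable function of the first
  \<open>k - 1\<close> noise variables, and disjoint blocks of an independent family are
  independent.\<close>

lemma (in prob_space) joint_distr_recursive_iterate:
  fixes W :: "nat \<Rightarrow> 'a \<Rightarrow> 'w"
  assumes indep: "indep_vars (\<lambda>_. N) W {1..}"
    and step: "\<And>k. k \<ge> 1 \<Longrightarrow> (\<lambda>(y, v). s k y v) \<in> (S \<Otimes>\<^sub>M N) \<rightarrow>\<^sub>M S"
    and x1: "x1 \<in> space S" "\<And>\<omega>. \<omega> \<in> space M \<Longrightarrow> x 1 \<omega> = x1"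
    and rec: "\<And>k \<omega>. k \<ge> 1 \<Longrightarrow> \<omega> \<in> space M \<Longrightarrow> x (Suc k) \<omega> = s k (x k \<omega>) (W k \<omega>)"
    and "k \<ge> 1"
  shows "random_variable S (x k)"
    and "distr M (S \<Otimes>\<^sub>M N) (\<lambda>\<omega>. (x k \<omega>, W k \<omega>)) = distr M S (x k) \<Otimes>\<^sub>M distr M N (W k)"
proof -
  have "\<exists>\<phi> \<in> PiM {1..<k} (\<lambda>_. N) \<rightarrow>\<^sub>M S. \<forall>\<omega>\<in>space M. x k \<omega> = \<phi> (restrict (\<lambda>i. W i \<omega>) {1..<k})"
    using \<open>k \<ge> 1\<close>
  proof (induction k rule: dec_induct)
    case base
    \<comment> \<open>At \<open>k = 1\<close> the block \<open>{1..<1}\<close> is empty and the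
      iterate is constant.\<close>
    show ?case using x1 by (intro bexI[of _ "\<lambda>_. x1"]) auto
  next
    case (step k)
    then obtain \<phi> where \<phi>_meas: "\<phi> \<in> PiM {1..<k} (\<lambda>_. N) \<rightarrow>\<^sub>M S"
      and \<phi>: "\<And>\<omega>. \<omega> \<in> space M \<Longrightarrow> x k \<omega> = \<phi> (restrict (\<lambda>i. W i \<omega>) {1..<k})" by blast
    define \<psi> where "\<psi> u = s k (\<phi> (restrict u {1..<k})) (u k)" for u
    have "\<psi> = (\<lambda>(y, v). s k y v) \<circ> (\<lambda>u. (\<phi> (restrict u {1..<k}), u k))"
      by (auto simp: \<psi>_def)
    moreover have "(\<lambda>u. restrict u {1..<k}) \<in> PiM {1..<Suc k} (\<lambda>_. N) \<rightarrow>\<^sub>M PiM {1..<k} (\<lambda>_. N)"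
      by (rule measurable_restrict_subset) auto
    then have "(\<lambda>u. (\<phi> (restrict u {1..<k}), u k)) \<in> PiM {1..<Suc k} (\<lambda>_. N) \<rightarrow>\<^sub>M (S \<Otimes>\<^sub>M N)"
      using step(1) by (intro measurable_Pair measurable_compose[OF _ \<phi>_meas]) auto
    ultimately have "\<psi> \<in> PiM {1..<Suc k} (\<lambda>_. N) \<rightarrow>\<^sub>M S"
      using assms(2)[OF step(1)] by (auto intro: measurable_comp)
    moreover have "x (Suc k) \<omega> = \<psi> (restrict (\<lambda>i. W i \<omega>) {1..<Suc k})" if "\<omega> \<in> space M" for \<omega>
    proof -
      have "restrict (restrict (\<lambda>i. W i \<omega>) {1..<Suc k}) {1..<k} = restrict (\<lambda>i. W i \<omega>) {1..<k}"
        by (auto simp: restrict_def)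
      then show ?thesis using rec[OF step(1) that] \<phi>[OF that] step(1) by (simp add: \<psi>_def)
    qed
    ultimately show ?case by blast
  qed
  then obtain \<phi> where \<phi>: "\<phi> \<in> PiM {1..<k} (\<lambda>_. N) \<rightarrow>\<^sub>M S"
      "\<And>\<omega>. \<omega> \<in> space M \<Longrightarrow> x k \<omega> = \<phi> (restrict (\<lambda>i. W i \<omega>) {1..<k})" by blast
  \<comment> \<open>The single variable \<open>W k\<close> is kept as a restriction to
    \<open>{k}\<close>, so that both blocks have the same type; evaluation at \<open>k\<close>
    recovers it.\<close>
  define U V where "U = (\<lambda>\<omega>. restrict (\<lambda>i. W i \<omega>) {1..<k})" and "V = (\<lambda>\<omega>. restrict (\<lambda>i. W i \<omega>) {k})"
  let ?PU = "PiM {1..<k} (\<lambda>_. N)" and ?PV = "PiM {k} (\<lambda>_. N)"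
  have "indep_var ?PU U ?PV V"
    unfolding U_def V_def using \<open>k \<ge> 1\<close> by (intro indep_var_restrict[OF indep]) auto
  then have U: "random_variable ?PU U" and V: "random_variable ?PV V"
    and UV: "distr M ?PU U \<Otimes>\<^sub>M distr M ?PV V = distr M (?PU \<Otimes>\<^sub>M ?PV) (\<lambda>\<omega>. (U \<omega>, V \<omega>))"
    unfolding indep_var_distribution_eq by auto
  have ev: "(\<lambda>v. v k) \<in> ?PV \<rightarrow>\<^sub>M N" by simp
  have x_cong: "distr M S (x k) = distr M S (\<lambda>\<omega>. \<phi> (U \<omega>))"
    "distr M (S \<Otimes>\<^sub>M N) (\<lambda>\<omega>. (x k \<omega>, W k \<omega>)) = distr M (S \<Otimes>\<^sub>M N) (\<lambda>\<omega>. (\<phi> (U \<omega>), V \<omega> k))"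
    by (auto intro!: distr_cong simp: \<phi>(2) U_def V_def)
  have W_eq: "distr M N (W k) = distr M N (\<lambda>\<omega>. V \<omega> k)"
    by (simp add: V_def)
  show "random_variable S (x k)"
    using measurable_compose[OF U \<phi>(1)] \<phi>(2) unfolding U_def by (simp cong: measurable_cong)
  interpret DU: prob_space "distr M ?PU U" by (rule prob_space_distr[OF U])
  interpret DV: prob_space "distr M ?PV V" by (rule prob_space_distr[OF V])
  interpret DW: prob_space "distr (distr M ?PV V) N (\<lambda>v. v k)"
    by (rule DV.prob_space_distr) (use ev in simp)
  have "distr M S (x k) \<Otimes>\<^sub>M distr M N (W k)
      = distr (distr M ?PU U) S \<phi> \<Otimes>\<^sub>M distr (distr M ?PV V) N (\<lambda>v. v k)"
    unfolding x_cong W_eq by (simp only: distr_distr[OF \<phi>(1) U] distr_distr[OF ev V] comp_def)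
  also have "\<dots> = distr (distr M ?PU U \<Otimes>\<^sub>M distr M ?PV V) (S \<Otimes>\<^sub>M N) (\<lambda>(u, v). (\<phi> u, v k))"
    using \<phi>(1) ev by (intro pair_measure_distr DW.sigma_finite_measure_axioms) auto
  also have "\<dots> = distr M (S \<Otimes>\<^sub>M N) ((\<lambda>(u, v). (\<phi> u, v k)) \<circ> (\<lambda>\<omega>. (U \<omega>, V \<omega>)))"
    unfolding UV using \<phi>(1) ev U V by (intro distr_distr) auto
  also have "\<dots> = distr M (S \<Otimes>\<^sub>M N) (\<lambda>\<omega>. (x k \<omega>, W k \<omega>))"
    unfolding x_cong by (simp add: comp_def)
  finally show "distr M (S \<Otimes>\<^sub>M N) (\<lambda>\<omega>. (x k \<omega>, W k \<omega>)) = distr M S (x k) \<Otimes>\<^sub>M distr M N (W k)"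
    by simp
qed

section \<open>The convergence rate\<close>

text \<open>Induction with the candidate \<open>\<nu> / k\<close>. Passing from \<open>k\<close> to
  \<open>Suc k\<close> multiplies the induction hypothesis by \<open>1 - t / k\<close>, which has
  the right sign once \<open>k \<ge> t\<close>; \<open>early\<close> supplies all indices up to
  \<open>t + 1\<close>. The factor 2 in the bound on \<open>P\<close> leaves a slack of
  \<open>(t - 1) / 2\<close>.\<close>

lemma harmonic_step_recursion:
  fixes a :: "nat \<Rightarrow> real"
  assumes t: "t > 1"
    and rec: "\<And>k. k \<ge> 1 \<Longrightarrow> a (Suc k) \<le> (1 - t / real k) * a k + P / (real k)\<^sup>2"
    and P: "2 * P / (t - 1) \<le> \<nu>"
    and early: "\<And>k. k \<ge> 1 \<Longrightarrow> real k \<le> t + 1 \<Longrightarrow> a k \<le> \<nu> / real k"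
    and "0 \<le> \<nu>" "k \<ge> 1"
  shows "a k \<le> \<nu> / real k"
  using \<open>k \<ge> 1\<close>
proof (induction k rule: dec_induct)
  case base
  then show ?case using early[of 1] t by simp
next
  case (step k)
  show ?case
  proof (cases "real (Suc k) \<le> t + 1")
    case True
    then show ?thesis using early[of "Suc k"] by simp
  next
    case False
    define q where "q = real k"
    have q: "q > t" "q \<ge> 1" using False step by (auto simp: q_def)
    have "a (Suc k) \<le> (1 - t / q) * a k + P / q\<^sup>2"
      using rec[of k] step by (simp add: q_def)
    also have "\<dots> \<le> (1 - t / q) * (\<nu> / q) + (\<nu> * (t - 1) / 2) / q\<^sup>2"
      using step q P t by (intro add_mono mult_left_mono divide_right_mono) (auto simp: q_def field_simps)
    also have "\<dots> = \<nu> * (q - (t + 1) / 2) / q\<^sup>2"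
      using q by (simp add: field_simps power2_eq_square)
    also have "\<dots> \<le> \<nu> * (1 / (q + 1))"
    proof -
      \<comment> \<open>The product below equals
        \<open>q\<^sup>2 - (t - 1) / 2 * q - (t + 1) / 2\<close>, and both subtracted terms are
        nonnegative.\<close>
      have "t * q \<ge> 1 * q" using t q by (intro mult_right_mono) auto
      then have "(q - (t + 1) / 2) * (q + 1) \<le> q\<^sup>2"
        using t by (simp add: field_simps power2_eq_square)
      then have "(q - (t + 1) / 2) / q\<^sup>2 \<le> 1 / (q + 1)"
        using q by (simp add: divide_simps)
      then show ?thesis using mult_left_mono[OF _ \<open>0 \<le> \<nu>\<close>] by fastforce
    qed
    finally show ?thesis by (simp add: q_def add.commute)
  qed
qed

theorem theorem5p2:
  fixes M :: "'a measure" and N :: "'w measure"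
    and w :: "'a \<Rightarrow> 'w" and W :: "nat \<Rightarrow> 'a \<Rightarrow> 'w"
    and X :: "(real ^ 'n) set"
    and fw :: "'m::finite \<Rightarrow> real ^ 'n \<Rightarrow> 'w \<Rightarrow> real"
    and f :: "'m \<Rightarrow> real ^ 'n \<Rightarrow> real"
    and g :: "'m \<Rightarrow> real ^ 'n \<Rightarrow> 'w \<Rightarrow> real ^ 'n"
    and \<alpha> :: "nat \<Rightarrow> real" and x1 :: "real ^ 'n"
    and x :: "nat \<Rightarrow> 'a \<Rightarrow> real ^ 'n"
    and lamg lamk :: "nat \<Rightarrow> 'a \<Rightarrow> real ^ 'm"
    and lam :: "real ^ 'n ^ 'm \<Rightarrow> real ^ 'm"
    and ls :: "real ^ 'm" and xs x0 :: "real ^ 'n"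
    and Li C Chat Gi Ghat ci :: "'m \<Rightarrow> real"
    and \<Theta> \<beta> \<gamma> L c Mnabla M1 MF Gsq GVsq LnablaS Lgsq MS Mbar :: real
  assumes m: "CARD('m) \<ge> 2"
    and X: "X \<noteq> {}" "closed X" "convex X"
    \<comment> \<open>randomness: w and independent copies W k, k = 1, 2, ...\<close>
    and M: "prob_space M"
    and w: "w \<in> measurable M N"
    and W_meas: "\<And>k. k \<ge> 1 \<Longrightarrow> W k \<in> measurable M N"
    and W_indep: "prob_space.indep_vars M (\<lambda>_. N) W {1..}"
    and W_distr: "\<And>k. k \<ge> 1 \<Longrightarrow> distr M N (W k) = distr M N w"
    \<comment> \<open>objectives\<close>
    and fw_int: "\<And>i y. integrable M (\<lambda>\<omega>. fw i y (w \<omega>))"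
    and f: "\<And>i y. f i y = (\<integral>\<omega>. fw i y (w \<omega>) \<partial>M)"
    \<comment> \<open>algorithm\<close>
    and g_meas: "\<And>i. (\<lambda>(y, v). g i y v) \<in> borel_measurable (borel \<Otimes>\<^sub>M N)"
    and x1: "x1 \<in> X"
    and SMG: "\<And>\<omega>. \<omega> \<in> space M \<Longrightarrow>
           SMG_path X g \<alpha> x1 (\<lambda>k. W k \<omega>) (\<lambda>k. lamg k \<omega>) (\<lambda>k. x k \<omega>)"
    and lamk: "\<And>k \<omega>. k \<ge> 1 \<Longrightarrow> \<omega> \<in> space M \<Longrightarrow>
           lamk k \<omega> \<in> subproblem_solutions (grad_tuple f (x k \<omega>))"
    \<comment> \<open>Lipschitz gradients\<close>
    and f_diff: "\<And>i y. f i differentiable (at y)"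
    and f_C1: "\<And>i. continuous_on UNIV (gradient (f i))"
    and Li_pos: "\<And>i. Li i > 0"
    and grad_Lip: "\<And>i y z. norm (gradient (f i) y - gradient (f i) z) \<le> Li i * norm (y - z)"
    and L: "L = Max (range Li)"
    \<comment> \<open>stochastic gradients; the inner integral over \<omega>' is the expectation w.r.t. w_k with x_k held fixed\<close>
    and g_int: "\<And>i k. k \<ge> 1 \<Longrightarrow> AE \<omega> in M.
           integrable M (\<lambda>\<omega>'. g i (x k \<omega>) (W k \<omega>')) \<and>
           integrable M (\<lambda>\<omega>'. (norm (g i (x k \<omega>) (W k \<omega>')))\<^sup>2)"
    and C_pos: "\<And>i. C i > 0" "\<And>i. Chat i > 0"
    and G_pos: "\<And>i. Gi i > 0" "\<And>i. Ghat i > 0"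
    and g_unbiased: "\<And>i k. k \<ge> 1 \<Longrightarrow> AE \<omega> in M.
           (\<integral>\<omega>'. g i (x k \<omega>) (W k \<omega>') \<partial>M) = gradient (f i) (x k \<omega>)"
    and g_dev: "\<And>i k. k \<ge> 1 \<Longrightarrow> AE \<omega> in M.
           (\<integral>\<omega>'. norm (g i (x k \<omega>) (W k \<omega>') - gradient (f i) (x k \<omega>)) \<partial>M)
             \<le> \<alpha> k * (C i + Chat i * norm (gradient (f i) (x k \<omega>)))"
    and g_var: "\<And>i k. k \<ge> 1 \<Longrightarrow> AE \<omega> in M.
           vec_variance M (\<lambda>\<omega>'. g i (x k \<omega>) (W k \<omega>'))
             \<le> (Gi i)\<^sup>2 + (Ghat i)\<^sup>2 * (norm (gradient (f i) (x k \<omega>)))\<^sup>2"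
    \<comment> \<open>bounded feasible region\<close>
    and X_bdd: "bounded X"
    and Theta: "\<Theta> > 0" "\<And>y z. y \<in> X \<Longrightarrow> z \<in> X \<Longrightarrow> norm (y - z) \<le> \<Theta>"
    \<comment> \<open>Lipschitz continuity of the subproblem solution\<close>
    and beta: "\<beta> > 0"
    and lam_sol: "\<And>v. v \<in> arising_tuples M X f g W x \<Longrightarrow> lam v \<in> subproblem_solutions v"
    and lam_Lip: "\<beta>-lipschitz_on (arising_tuples M X f g W x) lam"
    and lamg_lam: "\<And>k \<omega>. k \<ge> 1 \<Longrightarrow> \<omega> \<in> space M \<Longrightarrow>
           lamg k \<omega> = lam (stoch_tuple g (x k \<omega>) (W k \<omega>))"
    and lamk_lam: "\<And>k \<omega>. k \<ge> 1 \<Longrightarrow> \<omega> \<in> space M \<Longrightarrow>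
           lamk k \<omega> = lam (grad_tuple f (x k \<omega>))"
    \<comment> \<open>strong convexity\<close>
    and ci_pos: "\<And>i. ci i > 0"
    and strong_convex: "\<And>i y z. f i z \<ge> f i y + gradient (f i) y \<bullet> (z - y) + ci i / 2 * (norm (z - y))\<^sup>2"
    and c: "c = Min (range ci)"
    \<comment> \<open>limit weights and the corresponding Pareto minimizer\<close>
    and ls: "ls \<in> simplex_weights"
    and lamk_lim: "AE \<omega> in M. (\<lambda>k. lamk k \<omega>) \<longlonglongrightarrow> ls"
    and xs: "is_arg_min (\<lambda>y. weighted_sum f y ls) (\<lambda>y. y \<in> X) xs"
    and xs_unique: "\<And>y. is_arg_min (\<lambda>y. weighted_sum f y ls) (\<lambda>y. y \<in> X) y \<Longrightarrow> y = xs"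
    and xs_grad: "gradient (\<lambda>y. weighted_sum f y ls) xs = 0"
    and xs_descent: "AE \<omega> in M. \<forall>k\<ge>1.
           gradient (\<lambda>y. weighted_sum f y (lamk k \<omega>)) xs \<bullet> (x k \<omega> - xs) \<ge> 0"
    \<comment> \<open>step sizes\<close>
    and gamma: "\<gamma> > 1 / (2 * c)"
    and alpha: "\<And>k. k \<ge> 1 \<Longrightarrow> \<alpha> k = \<gamma> / real k"
    \<comment> \<open>constants\<close>
    and x0: "x0 \<in> X"
    and Mnabla: "Mnabla = Max (range (\<lambda>i. norm (gradient (f i) x0)))"
    and M1: "M1 = (\<Sum>i\<in>UNIV. C i)"
    and MF: "MF = Max (range Chat)"
    and Gsq: "Gsq = real CARD('m) * (\<Sum>i\<in>UNIV. (Gi i)\<^sup>2)"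
    and GVsq: "GVsq = real CARD('m) * Max (range (\<lambda>i. (Ghat i)\<^sup>2 + 1))"
    and LnablaS: "LnablaS = M1 + real CARD('m) * MF * (Mnabla + L * \<Theta>)"
    and Lgsq: "Lgsq = Gsq + real CARD('m) * GVsq * (Mnabla + L * \<Theta>)\<^sup>2"
    and MS: "MS = sqrt (real CARD('m) * real CARD('n)) * (Mnabla + L * \<Theta>)"
    and Mbar: "Mbar = Lgsq + 2 * \<Theta> * (LnablaS + \<beta> * LnablaS * MS)"
  shows "\<forall>k\<ge>1.
      (\<integral>\<omega>. (norm (x k \<omega> - xs))\<^sup>2 \<partial>M)
        \<le> max (2 * \<gamma>\<^sup>2 * Mbar * inverse (2 * c * \<gamma> - 1)) ((norm (x1 - xs))\<^sup>2) / real k \<and>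
      (\<integral>\<omega>. weighted_sum f (x k \<omega>) ls \<partial>M) - (\<integral>\<omega>. weighted_sum f xs ls \<partial>M)
        \<le> L / 2 * max (2 * \<gamma>\<^sup>2 * Mbar * inverse (2 * c * \<gamma> - 1)) ((norm (x1 - xs))\<^sup>2) / real k"
proof -

  \<comment> \<open>Constants and uniform gradient bounds\<close>
  interpret prob_space M by (rule M)
  have grad_S: "gradient (\<lambda>y. weighted_sum f y l) y = combination l (grad_tuple f y)" for l y
    using f_diff by (rule gradient_weighted_sum)
  \<comment> \<open>Bounds every objective gradient on \<open>X\<close>: the value at
    \<open>x0\<close> plus Lipschitz growth over a distance of at most
    \<open>\<Theta>\<close>.\<close>
  define Bd where "Bd = Mnabla + L * \<Theta>"
  have Li_le: "Li i \<le> L" for i unfolding L by (rule Max_ge) auto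
  have c_le: "c \<le> ci i" for i unfolding c by (rule Min_le) auto
  have c_pos: "c > 0"
    unfolding c by (subst Min_gr_iff) (auto simp: ci_pos)
  have L_lip: "norm (gradient (f i) y - gradient (f i) z) \<le> L * norm (y - z)" for i y z
    using grad_Lip[of i y z] mult_right_mono[OF Li_le, of "norm (y - z)" i] by simp
  \<comment> \<open>Test on a unit vector: strong monotonicity bounds the gradient increment from
    below, the Lipschitz condition from above.\<close>
  have "c \<le> L"
  proof -
    obtain i :: 'm where True by simp
    obtain e :: "real ^ 'n" where e: "norm e = 1" using vector_choose_size[of 1] by auto
    have "c * (norm (e - 0))\<^sup>2 \<le> ci i * (norm (e - 0))\<^sup>2"
      using c_le by (intro mult_right_mono) auto
    also have "\<dots> \<le> (gradient (f i) e - gradient (f i) 0) \<bullet> (e - 0)"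
      using strong_convex by (rule strongly_convex_monotone_gradient)
    also have "\<dots> \<le> norm (gradient (f i) e - gradient (f i) 0) * norm (e - 0)"
      by (rule norm_cauchy_schwarz)
    also have "\<dots> \<le> L" using L_lip[of i e 0] e by simp
    finally show ?thesis using e by simp
  qed
  have gamma_pos: "\<gamma> > 0" using gamma c_pos by (smt (verit) divide_pos_pos)
  have t: "2 * c * \<gamma> > 1" using gamma c_pos by (simp add: field_simps)
  have Mnabla_ge: "norm (gradient (f i) x0) \<le> Mnabla" for i unfolding Mnabla by (rule Max_ge) auto
  have Mnabla_nonneg: "0 \<le> Mnabla" using Mnabla_ge norm_ge_zero order_trans by blast
  have LT: "0 < L * \<Theta>" using \<open>c \<le> L\<close> c_pos Theta by simp
  have Bd: "0 < Bd" "L * \<Theta> \<le> Bd" using LT Mnabla_nonneg by (auto simp: Bd_def)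
  have grad_le: "norm (gradient (f i) y) \<le> Bd" if "y \<in> X" for i y
  proof -
    have "norm (gradient (f i) y) \<le> norm (gradient (f i) x0) + norm (gradient (f i) y - gradient (f i) x0)"
      by (rule norm_triangle_sub)
    also have "\<dots> \<le> Mnabla + L * norm (y - x0)" using Mnabla_ge L_lip by (intro add_mono)
    also have "\<dots> \<le> Bd" unfolding Bd_def
      using Theta(2)[OF that x0] \<open>c \<le> L\<close> c_pos by (intro add_left_mono mult_left_mono) auto
    finally show ?thesis .
  qed
  have MF_ge: "Chat i \<le> MF" for i unfolding MF by (rule Max_ge) auto
  have MF_pos: "0 < MF" using MF_ge C_pos(2) less_le_trans by blast
  have xs_in: "xs \<in> X" using xs by (simp add: is_arg_min_def)
  have alpha_pos: "\<alpha> k > 0" if "k \<ge> 1" for k using alpha[OF that] gamma_pos that by simp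

  \<comment> \<open>Iterates: feasibility, measurability and independence of the current
    noise\<close>
  have x_1: "x 1 \<omega> = x1" if "\<omega> \<in> space M" for \<omega>
    using SMG[OF that] by (simp add: SMG_path_def)
  have x_Suc: "x (Suc k) \<omega> = closest_point X
      (x k \<omega> - \<alpha> k *\<^sub>R combination (lamg k \<omega>) (stoch_tuple g (x k \<omega>) (W k \<omega>)))"
    if "k \<ge> 1" "\<omega> \<in> space M" for k \<omega>
    using SMG[OF that(2)] that(1) by (simp add: SMG_path_def)
  have x_in: "x k \<omega> \<in> X" if "k \<ge> 1" "\<omega> \<in> space M" for k \<omega>
  proof (cases "k = 1")
    case True
    then show ?thesis using x_1 x1 that(2) by simp
  next
    case False
    then obtain j where "k = Suc j" "j \<ge> 1" using \<open>k \<ge> 1\<close> by (cases k) auto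
    then show ?thesis using x_Suc[OF _ that(2)] closest_point_in_set[OF X(2,1)] by simp
  qed
  have arising_grad: "grad_tuple f (x k \<omega>) \<in> arising_tuples M X f g W x"
    and arising_stoch: "stoch_tuple g (x k \<omega>) (W k \<omega>) \<in> arising_tuples M X f g W x"
    if "k \<ge> 1" "\<omega> \<in> space M" for k \<omega>
    using that x_in[OF that] by (auto simp: arising_tuples_def)

  \<comment> \<open>\<open>lam\<close> is unconstrained off the arising tuples, so the recursion needs a Borel version of it\<close>
  obtain lam' where lam': "lam' \<in> borel_measurable borel"
      "\<And>v. v \<in> arising_tuples M X f g W x \<Longrightarrow> lam' v = lam v"
    using lipschitz_on_borel_extension[OF lam_Lip] by blast
  have x_Suc': "x (Suc k) \<omega> = closest_point X (x k \<omega> - \<alpha> k *\<^sub>R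
      combination (lam' (stoch_tuple g (x k \<omega>) (W k \<omega>))) (stoch_tuple g (x k \<omega>) (W k \<omega>)))"
    if "k \<ge> 1" "\<omega> \<in> space M" for k \<omega>
    using x_Suc[OF that] lamg_lam[OF that] lam'(2)[OF arising_stoch[OF that]] by simp
  \<comment> \<open>With the Borel weights \<open>lam'\<close> the step map is jointly measurable in
    the iterate and the noise.\<close>
  note iterate = joint_distr_recursive_iterate[where S = borel and N = N and W = W and x = x and ?x1.0 = x1
      and s = "\<lambda>k y v. closest_point X (y - \<alpha> k *\<^sub>R combination (lam' (stoch_tuple g y v)) (stoch_tuple g y v))",
      OF W_indep measurable_multi_gradient_step[OF g_meas X(3,2,1) lam'(1)] _ x_1 x_Suc']
  have x_meas: "random_variable borel (x k)" if "k \<ge> 1" for k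
    using that by (intro iterate(1)) auto
  have x_W: "distr M (borel \<Otimes>\<^sub>M N) (\<lambda>\<omega>. (x k \<omega>, W k \<omega>)) = distr M borel (x k) \<Otimes>\<^sub>M distr M N (W k)"
    if "k \<ge> 1" for k
    using that by (intro iterate(2)) auto
  note expectation_bound = joint_distr_expectation_bound[OF x_meas W_meas x_W]

  \<comment> \<open>Moment bounds for the stochastic gradients\<close>
  have grad_meas: "gradient (f i) \<in> borel_measurable borel" for i
    using f_C1 by (rule borel_measurable_continuous_onI)
  have dev_meas: "(\<lambda>(y, v). norm (g i y v - gradient (f i) y)) \<in> borel_measurable (borel \<Otimes>\<^sub>M N)" for i
    using g_meas[of i] measurable_compose[OF measurable_fst grad_meas]
    unfolding case_prod_beta by measurable
  have sq_meas: "(\<lambda>(y, v). (norm (g i y v))\<^sup>2) \<in> borel_measurable (borel \<Otimes>\<^sub>M N)" for i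
    using g_meas[of i] unfolding case_prod_beta by measurable

  define dev where "dev i k \<omega> = norm (g i (x k \<omega>) (W k \<omega>) - gradient (f i) (x k \<omega>))" for i k \<omega>
  define sq where "sq i k \<omega> = (norm (g i (x k \<omega>) (W k \<omega>)))\<^sup>2" for i k \<omega>
  have dev: "integrable M (dev i k)" "expectation (dev i k) \<le> \<alpha> k * (C i + MF * Bd)" if k: "k \<ge> 1" for i k
  proof -
    have inner: "AE \<omega> in M. integrable M (\<lambda>\<omega>'. norm (g i (x k \<omega>) (W k \<omega>') - gradient (f i) (x k \<omega>))) \<and>
        (\<integral>\<omega>'. norm (g i (x k \<omega>) (W k \<omega>') - gradient (f i) (x k \<omega>)) \<partial>M) \<le> \<alpha> k * (C i + MF * Bd)"
      using g_int[OF k, of i] g_dev[OF k, of i] AE_space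
    proof eventually_elim
      case (elim \<omega>)
      \<comment> \<open>Each \<open>Chat i\<close> is enlarged to the maximum \<open>MF\<close>, so
        that the sum over \<open>i\<close> becomes exactly \<open>LnablaS\<close>.\<close>
      have "\<alpha> k * (C i + Chat i * norm (gradient (f i) (x k \<omega>))) \<le> \<alpha> k * (C i + MF * Bd)"
        using alpha_pos[OF k] MF_ge[of i] MF_pos grad_le[OF x_in[OF k elim(3)]]
        by (intro mult_left_mono add_left_mono mult_mono) auto
      with elim show ?case by auto
    qed
    have "0 \<le> \<alpha> k * (C i + MF * Bd)"
      using alpha_pos[OF k] C_pos(1)[of i] MF_pos Bd by simp
    note * = expectation_bound[OF k k k dev_meas _ this inner]
    show "integrable M (dev i k)" "expectation (dev i k) \<le> \<alpha> k * (C i + MF * Bd)"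
      unfolding dev_def by (rule *; simp)+
  qed
  have sq: "integrable M (sq i k)" "expectation (sq i k) \<le> (Gi i)\<^sup>2 + ((Ghat i)\<^sup>2 + 1) * Bd\<^sup>2"
    if k: "k \<ge> 1" for i k
  proof -
    have inner: "AE \<omega> in M. integrable M (\<lambda>\<omega>'. (norm (g i (x k \<omega>) (W k \<omega>')))\<^sup>2) \<and>
        (\<integral>\<omega>'. (norm (g i (x k \<omega>) (W k \<omega>')))\<^sup>2 \<partial>M) \<le> (Gi i)\<^sup>2 + ((Ghat i)\<^sup>2 + 1) * Bd\<^sup>2"
      using g_int[OF k, of i] g_var[OF k, of i] g_unbiased[OF k, of i] AE_space
    proof eventually_elim
      case (elim \<omega>)
      \<comment> \<open>The second moment is the variance plus the squared norm of the mean; by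
        unbiasedness the latter is the squared gradient norm, whence the \<open>+ 1\<close>.\<close>
      have "(\<integral>\<omega>'. (norm (g i (x k \<omega>) (W k \<omega>')))\<^sup>2 \<partial>M)
          \<le> (Gi i)\<^sup>2 + ((Ghat i)\<^sup>2 + 1) * (norm (gradient (f i) (x k \<omega>)))\<^sup>2"
        using elim(2,3) by (simp add: vec_variance_def algebra_simps)
      also have "\<dots> \<le> (Gi i)\<^sup>2 + ((Ghat i)\<^sup>2 + 1) * Bd\<^sup>2"
        using grad_le[OF x_in[OF k elim(4)]] by (intro add_left_mono mult_left_mono power_mono) auto
      finally show ?case using elim(1) by simp
    qed
    have "0 \<le> (Gi i)\<^sup>2 + ((Ghat i)\<^sup>2 + 1) * Bd\<^sup>2" by simp
    note * = expectation_bound[OF k k k sq_meas _ this inner]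
    show "integrable M (sq i k)" "expectation (sq i k) \<le> (Gi i)\<^sup>2 + ((Ghat i)\<^sup>2 + 1) * Bd\<^sup>2"
      unfolding sq_def by (rule *; simp)+
  qed

  \<comment> \<open>One step along a sample path\<close>
  define A where "A k = expectation (\<lambda>\<omega>. (norm (x k \<omega> - xs))\<^sup>2)" for k
  have dist_le: "(norm (x k \<omega> - xs))\<^sup>2 \<le> \<Theta>\<^sup>2" if "k \<ge> 1" "\<omega> \<in> space M" for k \<omega>
    using Theta(2)[OF x_in[OF that] xs_in] by (intro power_mono) auto
  have dist_int: "integrable M (\<lambda>\<omega>. (norm (x k \<omega> - xs))\<^sup>2)" if "k \<ge> 1" for k
    using dist_le[OF that] x_meas[OF that]
    by (intro integrable_const_bound[where B = "\<Theta>\<^sup>2"]) auto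
  have A_le: "A k \<le> \<Theta>\<^sup>2" if "k \<ge> 1" for k
    unfolding A_def using dist_le[OF that] by (intro integral_le_const dist_int[OF that] AE_I2)

  have m_ge: "1 \<le> real CARD('m)" "1 \<le> real CARD('n)" using m by (auto simp: Suc_le_eq)
  have MS_nonneg: "0 \<le> MS" unfolding MS using Bd by (simp add: Bd_def)
  have grad_tuple_le: "norm (grad_tuple f y) \<le> MS" if "y \<in> X" for y
  proof -
    have "norm (grad_tuple f y) \<le> sqrt (real CARD('m)) * Bd"
      using grad_le[OF that] by (intro norm_vec_le_sqrt_card) (simp add: grad_tuple_def)
    also have "\<dots> \<le> sqrt (real CARD('m) * real CARD('n)) * Bd"
      using m_ge Bd mult_left_mono[OF m_ge(2), of "real CARD('m)"] by (intro mult_right_mono) auto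
    finally show ?thesis by (simp add: MS Bd_def)
  qed
  have step: "AE \<omega> in M. (norm (x (Suc k) \<omega> - xs))\<^sup>2 \<le> (1 - 2 * \<alpha> k * c) * (norm (x k \<omega> - xs))\<^sup>2
      + 2 * \<alpha> k * \<Theta> * (1 + \<beta> * MS) * (\<Sum>i\<in>UNIV. dev i k \<omega>) + (\<alpha> k)\<^sup>2 * (\<Sum>i\<in>UNIV. sq i k \<omega>)"
    if k: "k \<ge> 1" for k
    using xs_descent AE_space
  proof eventually_elim
    case (elim \<omega>)
    define y v v' where "y = x k \<omega>" and "v = stoch_tuple g y (W k \<omega>)" and "v' = grad_tuple f y"
    note defs = y_def v_def v'_def
    have lk: "lamk k \<omega> \<in> simplex_weights" and lg: "lamg k \<omega> \<in> simplex_weights"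
      using lamk[OF k elim(2)] lamg_lam[OF k elim(2)] lam_sol[OF arising_stoch[OF k elim(2)]]
        subproblem_solutions_simplex by auto
    have "norm (lamg k \<omega> - lamk k \<omega>) \<le> \<beta> * norm (v - v')"
      unfolding defs lamg_lam[OF k elim(2)] lamk_lam[OF k elim(2)]
      using lam_Lip arising_stoch[OF k elim(2)] arising_grad[OF k elim(2)] by (rule lipschitz_on_normD)
    moreover have "c * (norm (y - xs))\<^sup>2 \<le> combination (lamk k \<omega>) v' \<bullet> (y - xs)"
    proof -
      have "0 \<le> combination (lamk k \<omega>) (grad_tuple f xs) \<bullet> (y - xs)"
        using elim(1) k by (simp add: grad_S y_def)
      then show ?thesis
        using combination_gradient_strongly_monotone[where f = f, OF lk c_le strong_convex, of y xs]
        by (simp add: v'_def inner_diff_left)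
    qed
    ultimately have "(norm (x (Suc k) \<omega> - xs))\<^sup>2 \<le> (1 - 2 * \<alpha> k * c) * (norm (y - xs))\<^sup>2
        + 2 * \<alpha> k * \<Theta> * (1 + \<beta> * MS) * norm (v - v') + (\<alpha> k)\<^sup>2 * (norm v)\<^sup>2"
      unfolding x_Suc[OF k elim(2)] y_def[symmetric] v_def[symmetric]
      using X xs_in alpha_pos[OF k] beta norm_simplex_weights_le_1[OF lg] x_in[OF k elim(2)]
        grad_tuple_le[of y] Theta(2)[of y xs]
      by (intro multi_gradient_step_bound[where l' = "lamk k \<omega>"]) (auto simp: v'_def y_def)
    also have "norm (v - v') \<le> (\<Sum>i\<in>UNIV. dev i k \<omega>)"
      using norm_vec_le_sum[of "v - v'"] by (simp add: defs dev_def stoch_tuple_def grad_tuple_def)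
    also have "(norm v)\<^sup>2 = (\<Sum>i\<in>UNIV. sq i k \<omega>)"
      by (simp add: norm_vec_power2 defs sq_def stoch_tuple_def)
    finally show ?case
      using alpha_pos[OF k] Theta(1) beta MS_nonneg by (simp add: y_def mult_left_mono)
  qed

  \<comment> \<open>Recursion for the expected squared distance\<close>
  have LnablaS_eq: "(\<Sum>i\<in>UNIV. C i + MF * Bd) = LnablaS"
    by (simp add: LnablaS M1 Bd_def sum.distrib)
  have sq_sum: "(\<Sum>i\<in>UNIV. (Gi i)\<^sup>2 + ((Ghat i)\<^sup>2 + 1) * Bd\<^sup>2) \<le> Lgsq"
  proof -
    let ?K = "Max (range (\<lambda>i. (Ghat i)\<^sup>2 + 1))"
    have K: "(Ghat i)\<^sup>2 + 1 \<le> ?K" for i by (rule Max_ge) auto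
    have K_nonneg: "0 \<le> ?K" using order_trans[OF _ K[of undefined]] by simp
    have "(\<Sum>i\<in>UNIV. ((Ghat i)\<^sup>2 + 1) * Bd\<^sup>2) \<le> (\<Sum>i\<in>(UNIV :: 'm set). ?K * Bd\<^sup>2)"
      using K by (intro sum_mono mult_right_mono) auto
    also have "\<dots> \<le> real CARD('m) * (real CARD('m) * (?K * Bd\<^sup>2))"
      using K_nonneg m_ge mult_right_mono[OF m_ge(1), of "real CARD('m) * (?K * Bd\<^sup>2)"] by simp
    finally have "(\<Sum>i\<in>UNIV. ((Ghat i)\<^sup>2 + 1) * Bd\<^sup>2) \<le> real CARD('m) * GVsq * Bd\<^sup>2"
      by (simp add: GVsq mult.assoc)
    moreover have "(\<Sum>i\<in>UNIV. (Gi i)\<^sup>2) \<le> Gsq"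
      unfolding Gsq using mult_right_mono[OF m_ge(1), of "\<Sum>i\<in>UNIV. (Gi i)\<^sup>2"] by (simp add: sum_nonneg)
    ultimately show ?thesis by (simp add: Lgsq Bd_def sum.distrib)
  qed
  have A_Suc: "A (Suc k) \<le> (1 - 2 * c * \<gamma> / real k) * A k + \<gamma>\<^sup>2 * Mbar / (real k)\<^sup>2" if k: "k \<ge> 1" for k
  proof -
    have "A (Suc k) \<le> expectation (\<lambda>\<omega>. (1 - 2 * \<alpha> k * c) * (norm (x k \<omega> - xs))\<^sup>2
      + 2 * \<alpha> k * \<Theta> * (1 + \<beta> * MS) * (\<Sum>i\<in>UNIV. dev i k \<omega>) + (\<alpha> k)\<^sup>2 * (\<Sum>i\<in>UNIV. sq i k \<omega>))"
      unfolding A_def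
      by (intro integral_mono_AE step[OF k] dist_int Bochner_Integration.integrable_add
          integrable_mult_right Bochner_Integration.integrable_sum dev sq k) auto
    also have "\<dots> = (1 - 2 * \<alpha> k * c) * A k
      + 2 * \<alpha> k * \<Theta> * (1 + \<beta> * MS) * (\<Sum>i\<in>UNIV. expectation (dev i k)) + (\<alpha> k)\<^sup>2 * (\<Sum>i\<in>UNIV. expectation (sq i k))"
      unfolding A_def using dist_int[OF k] dev(1)[OF k] sq(1)[OF k] by simp
    also have "\<dots> \<le> (1 - 2 * \<alpha> k * c) * A k
      + 2 * \<alpha> k * \<Theta> * (1 + \<beta> * MS) * (\<Sum>i\<in>UNIV. \<alpha> k * (C i + MF * Bd))
      + (\<alpha> k)\<^sup>2 * (\<Sum>i\<in>UNIV. (Gi i)\<^sup>2 + ((Ghat i)\<^sup>2 + 1) * Bd\<^sup>2)"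
      using alpha_pos[OF k] Theta(1) beta MS_nonneg
      by (intro add_mono order_refl[of "(1 - 2 * \<alpha> k * c) * A k"] mult_left_mono sum_mono
          dev(2)[OF k] sq(2)[OF k]) auto
    \<comment> \<open>The expected deviation itself carries a factor \<open>\<alpha> k\<close>, so
      the bias is of order \<open>(\<alpha> k)\<^sup>2\<close> like the second moment; the two
      together form \<open>Mbar\<close>.\<close>
    also have "\<dots> \<le> (1 - 2 * \<alpha> k * c) * A k
      + 2 * \<alpha> k * \<Theta> * (1 + \<beta> * MS) * (\<alpha> k * LnablaS) + (\<alpha> k)\<^sup>2 * Lgsq"
      unfolding sum_distrib_left[symmetric] LnablaS_eq by (intro add_left_mono mult_left_mono sq_sum) auto
    also have "\<dots> = (1 - 2 * \<alpha> k * c) * A k + (\<alpha> k)\<^sup>2 * Mbar"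
      by (simp add: Mbar algebra_simps power2_eq_square)
    finally show ?thesis by (simp add: alpha[OF k] power_divide mult.commute mult.left_commute)
  qed

  \<comment> \<open>Lower bounds for the constant and the resulting rate\<close>
  define \<nu> where "\<nu> = max (2 * \<gamma>\<^sup>2 * Mbar * inverse (2 * c * \<gamma> - 1)) ((norm (x1 - xs))\<^sup>2)"
  have \<nu>_nonneg: "0 \<le> \<nu>" by (simp add: \<nu>_def le_max_iff_disj)
  have \<nu>_ge: "2 * (\<gamma>\<^sup>2 * Mbar) / (2 * c * \<gamma> - 1) \<le> \<nu>"
    unfolding \<nu>_def by (rule max.coboundedI1) (simp add: divide_inverse)
  have Mbar_ge: "4 * (c * \<Theta>)\<^sup>2 \<le> Mbar"
  proof -
    have "(c * \<Theta>)\<^sup>2 \<le> Bd\<^sup>2"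
      using order_trans[OF mult_right_mono[OF \<open>c \<le> L\<close>] Bd(2)] c_pos Theta(1) by (intro power_mono) auto
    \<comment> \<open>One factor \<open>CARD('m) \<ge> 2\<close> is explicit, a second one sits in
      \<open>GVsq\<close>, and the maximum there is at least 1.\<close>
    moreover have "4 \<le> real CARD('m) * GVsq"
    proof -
      have "1 \<le> (Ghat undefined)\<^sup>2 + 1" by simp
      also have "\<dots> \<le> Max (range (\<lambda>i. (Ghat i)\<^sup>2 + 1))" by (rule Max_ge) auto
      finally have "2 * 1 \<le> GVsq" unfolding GVsq using m by (intro mult_mono) auto
      then have "2 * 2 \<le> real CARD('m) * GVsq" using m by (intro mult_mono) auto
      then show ?thesis by simp
    qed
    ultimately have "4 * (c * \<Theta>)\<^sup>2 \<le> real CARD('m) * GVsq * Bd\<^sup>2" by (intro mult_mono) auto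
    moreover have "0 \<le> Gsq" unfolding Gsq by (simp add: sum_nonneg)
    moreover have "0 \<le> LnablaS"
      unfolding LnablaS_eq[symmetric] using C_pos(1) MF_pos Bd(1) by (intro sum_nonneg add_nonneg_nonneg) (auto simp: less_imp_le)
    then have "0 \<le> 2 * \<Theta> * (LnablaS + \<beta> * LnablaS * MS)" using Theta(1) beta MS_nonneg by simp
    ultimately show ?thesis unfolding Mbar Lgsq Bd_def by linarith
  qed
  \<comment> \<open>covers the steps with \<open>1 - 2 * c * \<gamma> / k < 0\<close>, where the bound \<open>A k \<le> \<Theta>\<^sup>2\<close> already suffices\<close>
  have \<nu>_early: "(2 * c * \<gamma> + 1) * \<Theta>\<^sup>2 \<le> \<nu>"
  proof -
    define t where "t = 2 * c * \<gamma>"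
    have "1 < t" using \<open>2 * c * \<gamma> > 1\<close> by (simp add: t_def)
    \<comment> \<open>Multiplying by \<open>t - 1\<close> clears the denominator of the rate
      constant, and \<open>t\<^sup>2 * \<Theta>\<^sup>2\<close> is \<open>\<gamma>\<^sup>2\<close>
      times the quantity bounded in \<open>Mbar_ge\<close>.\<close>
    have "((t + 1) * \<Theta>\<^sup>2) * (t - 1) = (t\<^sup>2 - 1) * \<Theta>\<^sup>2"
      by (simp add: algebra_simps power2_eq_square)
    also have "\<dots> \<le> 2 * t\<^sup>2 * \<Theta>\<^sup>2"
      by (intro mult_right_mono) (smt (verit) zero_le_power2, simp)
    also have "\<dots> = 2 * (\<gamma>\<^sup>2 * (4 * (c * \<Theta>)\<^sup>2))" by (simp add: t_def power2_eq_square)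
    also have "\<dots> \<le> 2 * (\<gamma>\<^sup>2 * Mbar)" using Mbar_ge by (intro mult_left_mono) auto
    finally have "(t + 1) * \<Theta>\<^sup>2 \<le> 2 * (\<gamma>\<^sup>2 * Mbar) / (t - 1)"
      using \<open>1 < t\<close> by (simp add: pos_le_divide_eq)
    then show ?thesis using \<nu>_ge unfolding t_def by linarith
  qed
  \<comment> \<open>The recursion lemma is used with \<open>t = 2 * c * \<gamma>\<close> and
    \<open>P = \<gamma>\<^sup>2 * Mbar\<close>; the open premise is \<open>early\<close>.\<close>
  have A_bound: "A k \<le> \<nu> / real k" if "k \<ge> 1" for k
    using t A_Suc \<nu>_ge _ \<nu>_nonneg that
  proof (rule harmonic_step_recursion)
    fix j :: nat assume j: "j \<ge> 1" "real j \<le> 2 * c * \<gamma> + 1"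
    have "A j * real j \<le> \<Theta>\<^sup>2 * (2 * c * \<gamma> + 1)"
      using A_le[OF j(1)] j by (intro mult_mono) auto
    then show "A j \<le> \<nu> / real j"
      using \<nu>_early j by (simp add: pos_le_divide_eq mult.commute)
  qed

  \<comment> \<open>Gap of the weighted objective\<close>
  have f_cont: "continuous_on UNIV (f i)" for i
    using f_diff by (simp add: continuous_on_eq_continuous_at differentiable_imp_continuous_within)
  \<comment> \<open>The linear term of the descent lemma vanishes because \<open>xs\<close> is
    stationary for the weights \<open>ls\<close>.\<close>
  have S_upper: "weighted_sum f y ls \<le> weighted_sum f xs ls + L / 2 * (norm (y - xs))\<^sup>2" for y
    using weighted_sum_upper_bound[where f = f, OF ls f_diff L_lip, of y xs] xs_grad
      grad_S[of ls xs] by simp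
  have S_bound: "expectation (\<lambda>\<omega>. weighted_sum f (x k \<omega>) ls) - expectation (\<lambda>\<omega>. weighted_sum f xs ls)
      \<le> L / 2 * \<nu> / real k" if k: "k \<ge> 1" for k
  proof -
    have cont: "continuous_on UNIV (\<lambda>y. weighted_sum f y ls)"
      unfolding weighted_sum_def by (intro continuous_intros f_cont)
    \<comment> \<open>Integrability of the objective at the iterates: they stay in the compact set
      \<open>X\<close>, where the continuous weighted sum is bounded.\<close>
    have "compact ((\<lambda>y. weighted_sum f y ls) ` X)"
      using X X_bdd cont by (intro compact_continuous_image) (auto simp: compact_eq_bounded_closed intro: continuous_on_subset)
    then obtain B where B: "\<And>y. y \<in> X \<Longrightarrow> norm (weighted_sum f y ls) \<le> B"
      by (metis compact_imp_bounded bounded_iff imageI)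
    have S_int: "integrable M (\<lambda>\<omega>. weighted_sum f (x k \<omega>) ls)"
      using B[OF x_in[OF k]] measurable_compose[OF x_meas[OF k] borel_measurable_continuous_onI[OF cont]]
      by (intro integrable_const_bound[where B = B] AE_I2)
    have "expectation (\<lambda>\<omega>. weighted_sum f (x k \<omega>) ls)
        \<le> expectation (\<lambda>\<omega>. weighted_sum f xs ls + L / 2 * (norm (x k \<omega> - xs))\<^sup>2)"
      by (intro integral_mono S_int S_upper Bochner_Integration.integrable_add integrable_mult_right dist_int[OF k]) auto
    also have "\<dots> = expectation (\<lambda>\<omega>. weighted_sum f xs ls) + L / 2 * A k"
      using dist_int[OF k] by (simp add: A_def)
    also have "L / 2 * A k \<le> L / 2 * (\<nu> / real k)"
      using A_bound[OF k] \<open>c \<le> L\<close> c_pos by (intro mult_left_mono) auto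
    finally show ?thesis by simp
  qed
  show ?thesis
    using A_bound S_bound unfolding A_def \<nu>_def by blast
qed

end
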